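(* Let $\mathbb{k}$ be a field with $\mathrm{char}(\mathbb{k})\neq 2$, let $\mathcal{G}$ be a finite simple graph, let $\mathfrak{g}=V\oplus W\oplus U$ be the solvable Lie algebra over $\mathbb{k}$ constructed from $\mathcal{G}$, and let $A$ be the $3$-clique incidence matrix of $\mathcal{G}$, regarded as a linear map $A:U\to V$. Then: (i) The center of $\mathfrak{g}$ is $$Z(\mathfrak{g})=\mathrm{span}\{e_\alpha : \alpha \text{ is an isolated vertex}\}\oplus\mathrm{span}\{e_\alpha\wedge e_\beta : (\alpha\beta)\in E_\Gamma\}\oplus\ker(A).$$ (ii) The nilradical (maximal nilpotent ideal) of $\mathfrak{g}$ is $$NR(\mathfrak{g})=V\oplus W\oplus\ker(A).$$
   Context: Lie algebra constructed from a graph. Let $\mathbb{k}$ be a field and $\mathcal{G}$ a finite simple graph with vertex set $V(\mathcal{G})=\{1,\dots,n\}$, edge set $E(\mathcal{G})$ (edges written $(ij)$), and set of $3$-cliques (triples of pairwise adjacent vertices) $C(\mathcal{G})$, written $(ijk)$ with $i<j<k$. Let $V$ be the $\mathbb{k}$-vector space with basis $\{e_i : i\in V(\mathcal{G})\}$, $W\subset\Lambda^2(V)$ the span of $\{e_i\wedge e_j : (ij)\in E(\mathcal{G})\}$, and $U$ the $\mathbb{k}$-vector space with basis $\{e_{ijk} : (ijk)\in C(\mathcal{G})\}$ (realized in $S^3(V)$ as $e_{ijk}=e_i\odot e_j\odot e_k$). The Lie algebra constructed from $\mathcal{G}$ is $\mathfrak{g}=V\oplus W\oplus U$ with the bilinear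 alternating bracket whose only nonzero values on pairs of basis elements (up to skew-symmetry) are: $[e_i,e_j]=e_i\wedge e_j$ if $(ij)\in E(\mathcal{G})$; $[e_a,e_{ijk}]=e_a$ if $a\in\{i,j,k\}$; $[e_a\wedge e_b,e_{ijk}]=2(e_a\wedge e_b)$ if $\{a,b\}\subset\{i,j,k\}$; $[e_a\wedge e_b,e_{ijk}]=e_a\wedge e_b$ if exactly one of $a,b$ lies in $\{i,j,k\}$; where $(ab)\in E(\mathcal{G})$ and $(ijk)\in C(\mathcal{G})$ in the last three relations as applicable. This is a solvable Lie algebra. Let $V_\Delta$ be the set of vertices belonging to some $3$-clique, $V_\Gamma=V(\mathcal{G})\setminus V_\Delta$, and $E_\Gamma$ the set of edges of $\mathcal{G}$ with both endpoints in $V_\Gamma$. The $3$-clique incidence matrix $A$ of $\mathcal{G}$ has rows indexed by vertices and columns indexed by $3$-cliques; the entry in row $i$ and column $(klm)$ is $1$ if $i\in\{k,l,m\}$ and $0$ otherwise. As a linear map $U\to V$ it is $A(e_{klm})=e_k+e_l+e_m$, so $\ker(A)\subset U$. *)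

theory Defs
  imports
    "HOL-Library.Function_Algebras"
    "HOL-Library.Product_Plus"
    "HOL-Computational_Algebra.Computational_Algebra"
begin

section \<open>Lie algebras on a carrier subspace\<close>

locale lie_algebra = vector_space scale
  for scale :: "'k::field \<Rightarrow> 'g::ab_group_add \<Rightarrow> 'g" +
  fixes L :: "'g set" and br :: "'g \<Rightarrow> 'g \<Rightarrow> 'g"
  assumes subspace_carrier: "subspace L"
    and closed: "\<lbrakk>x \<in> L; y \<in> L\<rbrakk> \<Longrightarrow> br x y \<in> L"
    and add_left: "\<lbrakk>x \<in> L; y \<in> L; z \<in> L\<rbrakk> \<Longrightarrow> br (x + y) z = br x z + br y z"
    and add_right: "\<lbrakk>x \<in> L; y \<in> L; z \<in> L\<rbrakk> \<Longrightarrow> br x (y + z) = br x y + br x z"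
    and scale_left_br: "\<lbrakk>x \<in> L; y \<in> L\<rbrakk> \<Longrightarrow> br (scale c x) y = scale c (br x y)"
    and scale_right_br: "\<lbrakk>x \<in> L; y \<in> L\<rbrakk> \<Longrightarrow> br x (scale c y) = scale c (br x y)"
    and alternating: "x \<in> L \<Longrightarrow> br x x = 0"
    and jacobi: "\<lbrakk>x \<in> L; y \<in> L; z \<in> L\<rbrakk> \<Longrightarrow>
      br x (br y z) + br y (br z x) + br z (br x y) = 0"

definition lie_center :: "'g::ab_group_add set \<Rightarrow> ('g \<Rightarrow> 'g \<Rightarrow> 'g) \<Rightarrow> 'g set"
  where "lie_center L br = {z \<in> L. \<forall>x\<in>L. br z x = 0}"

definition lie_ideal ::
    "('k::field \<Rightarrow> 'g::ab_group_add \<Rightarrow> 'g) \<Rightarrow> 'g set \<Rightarrow> ('g \<Rightarrow> 'g \<Rightarrow> 'g) \<Rightarrow> 'g set \<Rightarrow> bool"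
  where "lie_ideal scale L br I \<longleftrightarrow>
    module.subspace scale I \<and> I \<subseteq> L \<and> (\<forall>x\<in>L. \<forall>y\<in>I. br x y \<in> I)"

definition bracket_span ::
    "('k::field \<Rightarrow> 'g::ab_group_add \<Rightarrow> 'g) \<Rightarrow> ('g \<Rightarrow> 'g \<Rightarrow> 'g) \<Rightarrow> 'g set \<Rightarrow> 'g set \<Rightarrow> 'g set"
  where "bracket_span scale br S T = module.span scale {br x y | x y. x \<in> S \<and> y \<in> T}"

primrec lower_central ::
    "('k::field \<Rightarrow> 'g::ab_group_add \<Rightarrow> 'g) \<Rightarrow> ('g \<Rightarrow> 'g \<Rightarrow> 'g) \<Rightarrow> 'g set \<Rightarrow> nat \<Rightarrow> 'g set"
  where
    "lower_central scale br S 0 = S"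
  | "lower_central scale br S (Suc k) = bracket_span scale br S (lower_central scale br S k)"

definition lie_nilpotent ::
    "('k::field \<Rightarrow> 'g::ab_group_add \<Rightarrow> 'g) \<Rightarrow> ('g \<Rightarrow> 'g \<Rightarrow> 'g) \<Rightarrow> 'g set \<Rightarrow> bool"
  where "lie_nilpotent scale br S \<longleftrightarrow> (\<exists>k. lower_central scale br S k = {0})"

primrec derived_series ::
    "('k::field \<Rightarrow> 'g::ab_group_add \<Rightarrow> 'g) \<Rightarrow> ('g \<Rightarrow> 'g \<Rightarrow> 'g) \<Rightarrow> 'g set \<Rightarrow> nat \<Rightarrow> 'g set"
  where
    "derived_series scale br S 0 = S"
  | "derived_series scale br S (Suc k) =
      bracket_span scale br (derived_series scale br S k) (derived_series scale br S k)"

definition lie_solvable ::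
    "('k::field \<Rightarrow> 'g::ab_group_add \<Rightarrow> 'g) \<Rightarrow> ('g \<Rightarrow> 'g \<Rightarrow> 'g) \<Rightarrow> 'g set \<Rightarrow> bool"
  where "lie_solvable scale br S \<longleftrightarrow> (\<exists>k. derived_series scale br S k = {0})"

text \<open>The nilradical is the unique maximal nilpotent ideal, that is, the greatest element of the
  set of nilpotent ideals ordered by inclusion.\<close>

definition is_nilradical ::
    "('k::field \<Rightarrow> 'g::ab_group_add \<Rightarrow> 'g) \<Rightarrow> 'g set \<Rightarrow> ('g \<Rightarrow> 'g \<Rightarrow> 'g) \<Rightarrow> 'g set \<Rightarrow> bool"
  where "is_nilradical scale L br N \<longleftrightarrow>
    lie_ideal scale L br N \<and> lie_nilpotent scale br N \<and>
    (\<forall>I. lie_ideal scale L br I \<and> lie_nilpotent scale br I \<longrightarrow> I \<subseteq> N)"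


section \<open>Graphs on the vertex set \<open>{1..n}\<close>\<close>

text \<open>An edge \<open>(ij)\<close> is the set \<open>{i, j}\<close> and a 3-clique \<open>(ijk)\<close> is the set \<open>{i, j, k}\<close>.\<close>

definition simple_graph :: "nat \<Rightarrow> nat set set \<Rightarrow> bool"
  where "simple_graph n E \<longleftrightarrow> (\<forall>e\<in>E. e \<subseteq> {1..n} \<and> card e = 2)"

definition cliques3 :: "nat \<Rightarrow> nat set set \<Rightarrow> nat set set"
  where "cliques3 n E = {c. c \<subseteq> {1..n} \<and> card c = 3 \<and> (\<forall>i\<in>c. \<forall>j\<in>c. i \<noteq> j \<longrightarrow> {i, j} \<in> E)}"

definition isolated_vertices :: "nat \<Rightarrow> nat set set \<Rightarrow> nat set"
  where "isolated_vertices n E = {i \<in> {1..n}. \<forall>j\<in>{1..n}. {i, j} \<notin> E}"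

definition V_Delta :: "nat \<Rightarrow> nat set set \<Rightarrow> nat set"
  where "V_Delta n E = \<Union> (cliques3 n E)"

definition V_Gamma :: "nat \<Rightarrow> nat set set \<Rightarrow> nat set"
  where "V_Gamma n E = {1..n} - V_Delta n E"

definition E_Gamma :: "nat \<Rightarrow> nat set set \<Rightarrow> nat set set"
  where "E_Gamma n E = {e \<in> E. e \<subseteq> V_Gamma n E}"


section \<open>The spaces \<open>V\<close>, \<open>W\<close>, \<open>U\<close>\<close>

definition fscale :: "'k::field \<Rightarrow> ('i \<Rightarrow> 'k) \<Rightarrow> 'i \<Rightarrow> 'k"
  where "fscale c f = (\<lambda>i. c * f i)"

abbreviation fspan :: "('i \<Rightarrow> 'k::field) set \<Rightarrow> ('i \<Rightarrow> 'k) set"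
  where "fspan \<equiv> module.span fscale"

definition evec :: "'i \<Rightarrow> 'i \<Rightarrow> 'k::field"
  where "evec i = (\<lambda>j. if j = i then 1 else 0)"

text \<open>The exterior square of \<open>V\<close> is realized, in every characteristic, as the space of alternating
  matrices, with \<open>v \<and> w\<close> the matrix \<open>v w\<^sup>T - w v\<^sup>T\<close>.  An element of \<open>W\<close> is therefore determined by
  its entries \<open>(i, j)\<close> with \<open>i < j\<close>, which are its coordinates in the basis \<open>e\<^sub>i \<and> e\<^sub>j\<close>.\<close>

definition wedge :: "('i \<Rightarrow> 'k::field) \<Rightarrow> ('i \<Rightarrow> 'k) \<Rightarrow> 'i \<times> 'i \<Rightarrow> 'k"
  where "wedge v w = (\<lambda>(i, j). v i * w j - v j * w i)"

definition V_space :: "nat \<Rightarrow> (nat \<Rightarrow> 'k::field) set"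
  where "V_space n = fspan {evec i | i. i \<in> {1..n}}"

definition W_space :: "nat set set \<Rightarrow> (nat \<times> nat \<Rightarrow> 'k::field) set"
  where "W_space E = fspan {wedge (evec i) (evec j) | i j. {i, j} \<in> E}"

definition U_space :: "nat \<Rightarrow> nat set set \<Rightarrow> (nat set \<Rightarrow> 'k::field) set"
  where "U_space n E = fspan {evec c | c. c \<in> cliques3 n E}"

definition clique_incidence :: "nat \<Rightarrow> nat set \<Rightarrow> 'k::field"
  where "clique_incidence i c = (if i \<in> c then 1 else 0)"

definition A_map :: "nat \<Rightarrow> nat set set \<Rightarrow> (nat set \<Rightarrow> 'k::field) \<Rightarrow> nat \<Rightarrow> 'k"
  where "A_map n E u =
    (\<lambda>i. if i \<in> {1..n} then \<Sum>c\<in>cliques3 n E. clique_incidence i c * u c else 0)"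

definition ker_A :: "nat \<Rightarrow> nat set set \<Rightarrow> (nat set \<Rightarrow> 'k::field) set"
  where "ker_A n E = {u \<in> U_space n E. A_map n E u = 0}"


section \<open>The Lie algebra of a graph\<close>

text \<open>The direct sum \<open>V \<oplus> W \<oplus> U\<close> is taken externally, so that a direct sum of subspaces of \<open>V\<close>, \<open>W\<close>
  and \<open>U\<close> is their cartesian product.\<close>

type_synonym 'k graph_vec = "(nat \<Rightarrow> 'k) \<times> (nat \<times> nat \<Rightarrow> 'k) \<times> (nat set \<Rightarrow> 'k)"

definition gscale :: "'k::field \<Rightarrow> 'k graph_vec \<Rightarrow> 'k graph_vec"
  where "gscale c = (\<lambda>(v, w, u). (fscale c v, fscale c w, fscale c u))"

definition graph_lie :: "nat \<Rightarrow> nat set set \<Rightarrow> 'k::field graph_vec set"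
  where "graph_lie n E = V_space n \<times> W_space E \<times> U_space n E"

datatype basis_index = Vert nat | Edge nat nat | Clique "nat set"

definition basis_indices :: "nat \<Rightarrow> nat set set \<Rightarrow> basis_index set"
  where "basis_indices n E =
    Vert ` {1..n} \<union> {Edge i j | i j. i < j \<and> {i, j} \<in> E} \<union> Clique ` cliques3 n E"

fun basis_elem :: "basis_index \<Rightarrow> 'k::field graph_vec"
  where
    "basis_elem (Vert i) = (evec i, 0, 0)"
  | "basis_elem (Edge i j) = (0, wedge (evec i) (evec j), 0)"
  | "basis_elem (Clique c) = (0, 0, evec c)"

fun basis_coord :: "basis_index \<Rightarrow> 'k::field graph_vec \<Rightarrow> 'k"
  where
    "basis_coord (Vert i) (v, w, u) = v i"
  | "basis_coord (Edge i j) (v, w, u) = w (i, j)"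
  | "basis_coord (Clique c) (v, w, u) = u c"

fun basis_bracket :: "nat set set \<Rightarrow> basis_index \<Rightarrow> basis_index \<Rightarrow> 'k::field graph_vec"
  where
    "basis_bracket E (Vert i) (Vert j) =
      (if {i, j} \<in> E then (0, wedge (evec i) (evec j), 0) else 0)"
  | "basis_bracket E (Vert a) (Clique c) = (if a \<in> c then basis_elem (Vert a) else 0)"
  | "basis_bracket E (Clique c) (Vert a) = - (if a \<in> c then basis_elem (Vert a) else 0)"
  | "basis_bracket E (Edge a b) (Clique c) =
      (if {a, b} \<subseteq> c then gscale 2 (basis_elem (Edge a b))
       else if a \<in> c \<or> b \<in> c then basis_elem (Edge a b)
       else 0)"
  | "basis_bracket E (Clique c) (Edge a b) =
      - (if {a, b} \<subseteq> c then gscale 2 (basis_elem (Edge a b))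
         else if a \<in> c \<or> b \<in> c then basis_elem (Edge a b)
         else 0)"
  | "basis_bracket E _ _ = 0"

definition graph_bracket ::
    "nat \<Rightarrow> nat set set \<Rightarrow> 'k::field graph_vec \<Rightarrow> 'k graph_vec \<Rightarrow> 'k graph_vec"
  where "graph_bracket n E x y =
    (\<Sum>p\<in>basis_indices n E. \<Sum>q\<in>basis_indices n E.
      gscale (basis_coord p x * basis_coord q y) (basis_bracket E p q))"


section \<open>The construction is a solvable Lie algebra with the prescribed brackets\<close>

interpretation fvs: vector_space "fscale :: 'k::field \<Rightarrow> ('i \<Rightarrow> 'k) \<Rightarrow> 'i \<Rightarrow> 'k"
  by unfold_locales (auto simp: fscale_def fun_eq_iff algebra_simps)

interpretation gvs: vector_space "gscale :: 'k::field \<Rightarrow> 'k graph_vec \<Rightarrow> 'k graph_vec"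
  by unfold_locales (auto simp: gscale_def fscale_def fun_eq_iff algebra_simps)

lemma sum_fun_apply: "(\<Sum>i\<in>S. f i) x = (\<Sum>i\<in>S. f i x :: 'k::comm_monoid_add)"
  by (induction S rule: infinite_finite_induct) auto

lemma span_evec:
  assumes "finite S"
  shows "fspan {evec i | i. i \<in> S} = {f :: 'i \<Rightarrow> 'k::field. \<forall>i. i \<notin> S \<longrightarrow> f i = 0}"
proof (rule fvs.span_unique)
  show "{evec i | i. i \<in> S} \<subseteq> {f :: 'i \<Rightarrow> 'k. \<forall>i. i \<notin> S \<longrightarrow> f i = 0}"
    by (auto simp: evec_def)
  show "fvs.subspace {f :: 'i \<Rightarrow> 'k. \<forall>i. i \<notin> S \<longrightarrow> f i = 0}"
    by (auto simp: fvs.subspace_def fscale_def)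
  fix T :: "('i \<Rightarrow> 'k) set"
  assume T: "{evec i | i. i \<in> S} \<subseteq> T" "fvs.subspace T"
  show "{f. \<forall>i. i \<notin> S \<longrightarrow> f i = 0} \<subseteq> T"
  proof
    fix f :: "'i \<Rightarrow> 'k" assume "f \<in> {f. \<forall>i. i \<notin> S \<longrightarrow> f i = 0}"
    then have "f = (\<Sum>i\<in>S. fscale (f i) (evec i))"
      using assms by (auto simp: fun_eq_iff sum_fun_apply fscale_def evec_def if_distrib
          cong: if_cong)
    also have "\<dots> \<in> T"
      using T by (intro fvs.subspace_sum fvs.subspace_scale) auto
    finally show "f \<in> T" .
  qed
qed

lemma finite_cliques3: "finite (cliques3 n E)"
  by (rule finite_subset[of _ "Pow {1..n}"]) (auto simp: cliques3_def)

lemma mem_V_space: "v \<in> V_space n \<longleftrightarrow> (\<forall>i. i \<notin> {1..n} \<longrightarrow> v i = 0)"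
  unfolding V_space_def by (subst span_evec) auto

lemma mem_U_space: "u \<in> U_space n E \<longleftrightarrow> (\<forall>c. c \<notin> cliques3 n E \<longrightarrow> u c = 0)"
  unfolding U_space_def by (subst span_evec) (auto simp: finite_cliques3)

definition ordered_edges :: "nat set set \<Rightarrow> (nat \<times> nat) set"
  where "ordered_edges E = {(i, j). i < j \<and> {i, j} \<in> E}"

lemma finite_ordered_edges:
  assumes "simple_graph n E" shows "finite (ordered_edges E)"
  by (rule finite_subset[of _ "{1..n} \<times> {1..n}"])
    (use assms in \<open>auto simp: ordered_edges_def simple_graph_def\<close>)

lemma simple_graph_noloop: "simple_graph n E \<Longrightarrow> {i} \<notin> E"
  by (auto simp: simple_graph_def)

lemma simple_graph_edgeD:
  assumes "simple_graph n E" "{i, j} \<in> E" shows "i \<in> {1..n}" "j \<in> {1..n}" "i \<noteq> j"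
  using assms by (auto simp: simple_graph_def)

lemma wedge_evec_at:
  fixes i j a b :: nat
  assumes "i < j"
  shows "wedge (evec i) (evec j) (a, b) =
    (if (a, b) = (i, j) then 1 else if (b, a) = (i, j) then -1 else 0 :: 'k::field)"
proof -
  have "i \<noteq> j" using assms by simp
  then show ?thesis
    unfolding wedge_def evec_def prod.case prod.inject by (simp split: if_split)
qed

lemma wedge_evec_swap: "wedge (evec j) (evec i) = - wedge (evec i) (evec j)"
  by (auto simp: wedge_def fun_eq_iff)

definition edge_matrices :: "nat set set \<Rightarrow> (nat \<times> nat \<Rightarrow> 'k::field) set"
  where "edge_matrices E =
    {w. (\<forall>i. w (i, i) = 0) \<and> (\<forall>i j. w (i, j) + w (j, i) = 0) \<and> (\<forall>i j. {i, j} \<notin> E \<longrightarrow> w (i, j) = 0)}"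

lemma edge_matrixD:
  assumes "w \<in> edge_matrices E"
  shows "w (i, i) = 0" "w (j, i) = - w (i, j)" "{i, j} \<notin> E \<Longrightarrow> w (i, j) = 0"
  using assms by (auto simp: edge_matrices_def eq_neg_iff_add_eq_0 add.commute)

lemma wedge_in_edge_matrices:
  assumes "{i, j} \<in> E" shows "wedge (evec i) (evec j) \<in> edge_matrices E"
  unfolding edge_matrices_def
proof (intro CollectI conjI allI impI)
  fix a b assume "{a, b} \<notin> E"
  then have "\<not> (a = i \<and> b = j)" "\<not> (a = j \<and> b = i)"
    using assms by (auto simp: insert_commute)
  then show "wedge (evec i) (evec j) (a, b) = 0"
    by (auto simp: wedge_def evec_def)
qed (simp_all add: wedge_def)

lemma zero_in_edge_matrices: "0 \<in> edge_matrices E"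
  by (simp add: edge_matrices_def)

lemma edge_matrix_expand:
  fixes w :: "nat \<times> nat \<Rightarrow> 'k::field"
  assumes "simple_graph n E" and w: "w \<in> edge_matrices E"
  shows "w (a, b) = (\<Sum>(i, j)\<in>ordered_edges E. w (i, j) * wedge (evec i) (evec j) (a, b))"
proof -
  have *: "w p * wedge (evec (fst p)) (evec (snd p)) (a, b) =
      (if p = (a, b) then w (a, b) else 0) - (if p = (b, a) then w (b, a) else 0)"
    if pE: "p \<in> ordered_edges E" for p :: "nat \<times> nat"
  proof -
    obtain i j where p: "p = (i, j)" "i < j" using pE unfolding ordered_edges_def by blast
    show ?thesis unfolding p fst_conv snd_conv wedge_evec_at[OF p(2)] using p(2) by simp
  qed
  have "(\<Sum>(i, j)\<in>ordered_edges E. w (i, j) * wedge (evec i) (evec j) (a, b)) =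
      (\<Sum>p\<in>ordered_edges E.
        (if p = (a, b) then w (a, b) else 0) - (if p = (b, a) then w (b, a) else 0))"
    by (intro sum.cong refl) (simp add: case_prod_unfold *)
  also have "\<dots> = (if (a, b) \<in> ordered_edges E then w (a, b) else 0)
      - (if (b, a) \<in> ordered_edges E then w (b, a) else 0)"
    using finite_ordered_edges[OF assms(1)] by (simp add: sum_subtractf)
  also have "\<dots> = w (a, b)"
  proof -
    have "{b, a} = {a, b}" by auto
    moreover have "a = b \<Longrightarrow> w (a, b) = 0" "{a, b} \<notin> E \<Longrightarrow> w (a, b) = 0"
      using edge_matrixD(1,3)[OF w] by auto
    ultimately show ?thesis
      unfolding ordered_edges_def edge_matrixD(2)[OF w, of b a] by (auto simp: not_less_iff_gr_or_eq)
  qed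
  finally show ?thesis by simp
qed

lemma W_space_eq:
  assumes "simple_graph n E"
  shows "W_space E = (edge_matrices E :: (nat \<times> nat \<Rightarrow> 'k::field) set)"
  unfolding W_space_def
proof (rule fvs.span_unique)
  show "{wedge (evec i) (evec j) | i j. {i, j} \<in> E} \<subseteq> (edge_matrices E :: (_ \<Rightarrow> 'k) set)"
    using wedge_in_edge_matrices by blast
  show "fvs.subspace (edge_matrices E :: (_ \<Rightarrow> 'k) set)"
    by (auto simp: fvs.subspace_def fscale_def edge_matrices_def algebra_simps
        simp flip: distrib_left)
  fix T :: "(nat \<times> nat \<Rightarrow> 'k) set"
  assume T: "{wedge (evec i) (evec j) | i j. {i, j} \<in> E} \<subseteq> T" "fvs.subspace T"
  show "edge_matrices E \<subseteq> T"
  proof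
    fix w :: "nat \<times> nat \<Rightarrow> 'k" assume w: "w \<in> edge_matrices E"
    have "w = (\<Sum>(i, j)\<in>ordered_edges E. fscale (w (i, j)) (wedge (evec i) (evec j)))"
    proof
      fix p :: "nat \<times> nat"
      obtain a b where p: "p = (a, b)" by (cases p)
      show "w p = (\<Sum>(i, j)\<in>ordered_edges E. fscale (w (i, j)) (wedge (evec i) (evec j))) p"
        unfolding p using edge_matrix_expand[OF assms w, of a b]
        by (simp add: sum_fun_apply fscale_def case_prod_unfold)
    qed
    also have "\<dots> \<in> T"
      using T by (auto intro!: fvs.subspace_sum fvs.subspace_scale simp: ordered_edges_def)
    finally show "w \<in> T" .
  qed
qed

lemma mem_graph_lie:
  assumes "simple_graph n E"
  shows "(v, w, u) \<in> graph_lie n E \<longleftrightarrow>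
    (\<forall>i. i \<notin> {1..n} \<longrightarrow> v i = 0) \<and> w \<in> edge_matrices E \<and> (\<forall>c. c \<notin> cliques3 n E \<longrightarrow> u c = 0)"
  by (simp add: graph_lie_def mem_V_space mem_U_space W_space_eq[OF assms])

lemma sum_basis_indices:
  assumes "simple_graph n E"
  shows "sum f (basis_indices n E) =
    (\<Sum>i\<in>{1..n}. f (Vert i)) + (\<Sum>(i, j)\<in>ordered_edges E. f (Edge i j))
      + (\<Sum>c\<in>cliques3 n E. f (Clique c))"
proof -
  have B: "basis_indices n E =
      (Vert ` {1..n} \<union> (\<lambda>(i, j). Edge i j) ` ordered_edges E) \<union> Clique ` cliques3 n E"
    by (auto simp: basis_indices_def ordered_edges_def)
  have "sum f (basis_indices n E) = sum f (Vert ` {1..n}) +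
      sum f ((\<lambda>(i, j). Edge i j) ` ordered_edges E) + sum f (Clique ` cliques3 n E)"
    unfolding B using finite_cliques3[of n E] finite_ordered_edges[OF assms]
    by (subst sum.union_disjoint; (subst sum.union_disjoint)?) auto
  moreover have "sum f ((\<lambda>(i, j). Edge i j) ` ordered_edges E) =
      (\<Sum>(i, j)\<in>ordered_edges E. f (Edge i j))"
    by (subst sum.reindex) (auto simp: inj_on_def case_prod_unfold)
  moreover have "sum f (Vert ` {1..n}) = (\<Sum>i\<in>{1..n}. f (Vert i))"
    "sum f (Clique ` cliques3 n E) = (\<Sum>c\<in>cliques3 n E. f (Clique c))"
    by (auto simp: sum.reindex inj_on_def)
  ultimately show ?thesis by simp
qed

lemma evec_expand:
  assumes "finite S" "\<And>i. i \<notin> S \<Longrightarrow> f i = 0"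
  shows "(\<Sum>i\<in>S. fscale (f i) (evec i)) = f"
  using assms
  by (auto simp: fun_eq_iff sum_fun_apply fscale_def evec_def if_distrib cong: if_cong)

lemma basis_expansion:
  assumes "simple_graph n E" "x \<in> graph_lie n E"
  shows "(\<Sum>p\<in>basis_indices n E. gscale (basis_coord p x) (basis_elem p)) = x"
proof -
  obtain v w u where x: "x = (v, w, u)" by (cases x)
  note m = assms(2)[unfolded x mem_graph_lie[OF assms(1)]]
  have v: "(\<Sum>i\<in>{1..n}. fscale (v i) (evec i)) = v"
    using m by (intro evec_expand) auto
  have u: "(\<Sum>c\<in>cliques3 n E. fscale (u c) (evec c)) = u"
    using m finite_cliques3[of n E] by (intro evec_expand) auto
  have w: "(\<Sum>(i, j)\<in>ordered_edges E. fscale (w (i, j)) (wedge (evec i) (evec j))) = w"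
    (is "?s = w")
  proof
    fix p :: "nat \<times> nat"
    obtain a b where p: "p = (a, b)" by (cases p)
    show "?s p = w p"
      unfolding p using m edge_matrix_expand[OF assms(1), of w a b]
      by (simp add: sum_fun_apply fscale_def case_prod_unfold)
  qed
  show ?thesis
    unfolding sum_basis_indices[OF assms(1)] x prod_eq_iff fst_add snd_add fst_sum snd_sum
    using v w u
    by (simp add: fst_sum snd_sum gscale_def case_prod_unfold)
qed

lemma basis_elem_mem:
  assumes "simple_graph n E" "p \<in> basis_indices n E"
  shows "basis_elem p \<in> graph_lie n E"
  using assms(2)
  by (auto simp: basis_indices_def mem_graph_lie[OF assms(1)] wedge_in_edge_matrices zero_in_edge_matrices)
    (auto simp: evec_def)

lemma basis_coord_elem:
  assumes "p \<in> basis_indices n E" "q \<in> basis_indices n E"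
  shows "basis_coord p (basis_elem q) = (if p = q then 1 else 0)"
  using assms by (auto simp: basis_indices_def wedge_evec_at)
    (auto simp: evec_def split: if_splits)

lemma finite_basis_indices:
  assumes "simple_graph n E" shows "finite (basis_indices n E)"
proof -
  have "{Edge i j | i j. i < j \<and> {i, j} \<in> E} = (\<lambda>(i, j). Edge i j) ` ordered_edges E"
    by (auto simp: ordered_edges_def)
  then show ?thesis
    using finite_ordered_edges[OF assms] by (simp add: basis_indices_def finite_cliques3)
qed

lemma graph_bracket_basis:
  assumes "simple_graph n E" "p \<in> basis_indices n E" "q \<in> basis_indices n E"
  shows "graph_bracket n E (basis_elem p) (basis_elem q) = basis_bracket E p q"
proof -
  have "graph_bracket n E (basis_elem p) (basis_elem q) =
      (\<Sum>p'\<in>basis_indices n E. \<Sum>q'\<in>basis_indices n E.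
        if p' = p then if q' = q then basis_bracket E p q else 0 else 0)"
    unfolding graph_bracket_def using assms
    by (intro sum.cong refl) (auto simp: basis_coord_elem)
  also have "\<dots> = (\<Sum>p'\<in>basis_indices n E. if p' = p then basis_bracket E p q else 0)"
    using assms finite_basis_indices[OF assms(1)] by (intro sum.cong refl) auto
  also have "\<dots> = basis_bracket E p q"
    using assms finite_basis_indices[OF assms(1)] by auto
  finally show ?thesis .
qed

lemma A_map_evec:
  assumes "c \<in> cliques3 n E"
  shows "A_map n E (evec c) = (\<lambda>i. if i \<in> c then 1 else 0)"
    and "A_map n E (evec c) = (\<Sum>i\<in>c. evec i)"
proof -
  have c: "finite c" "c \<subseteq> {1..n}"
    using assms by (auto simp: cliques3_def intro!: card_ge_0_finite)
  show *: "A_map n E (evec c) = (\<lambda>i. if i \<in> c then 1 else 0)"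
  proof
    fix i
    have "(\<Sum>d\<in>cliques3 n E. clique_incidence i d * evec c d) =
        (\<Sum>d\<in>cliques3 n E. if d = c then clique_incidence i c else 0)"
      by (intro sum.cong) (auto simp: evec_def)
    then show "A_map n E (evec c) i = (if i \<in> c then 1 else 0)"
      using assms c by (auto simp: A_map_def finite_cliques3 clique_incidence_def)
  qed
  show "A_map n E (evec c) = (\<Sum>i\<in>c. evec i)"
    unfolding * using c by (auto simp: evec_def fun_eq_iff sum_fun_apply)
qed

lemma A_map_linear:
  "A_map n E (u + u') = A_map n E u + A_map n E u'"
  "A_map n E (fscale c u) = fscale c (A_map n E u)"
  "A_map n E 0 = 0"
  by (auto simp: A_map_def fun_eq_iff fscale_def algebra_simps sum.distrib sum_distrib_left)

lemma A_map_scale: "A_map n E (\<lambda>c. k * u c) i = k * A_map n E u i"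
  by (simp add: A_map_def sum_distrib_left mult.left_commute)

text \<open>A coordinate formula for the bracket.\<close>

definition bracket_formula ::
    "nat \<Rightarrow> nat set set \<Rightarrow> 'k::field graph_vec \<Rightarrow> 'k graph_vec \<Rightarrow> 'k graph_vec"
  where "bracket_formula n E = (\<lambda>(v, w, u) (v', w', u').
    ((\<lambda>a. v a * A_map n E u' a - v' a * A_map n E u a),
     (\<lambda>(a, b). (if {a, b} \<in> E then v a * v' b - v b * v' a else 0)
        + w (a, b) * (A_map n E u' a + A_map n E u' b)
        - w' (a, b) * (A_map n E u a + A_map n E u b)),
     0))"

lemma bracket_formula_bilinear:
  "bracket_formula n E (x + y) z = bracket_formula n E x z + bracket_formula n E y z"
  "bracket_formula n E x (y + z) = bracket_formula n E x y + bracket_formula n E x z"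
  "bracket_formula n E (gscale c x) y = gscale c (bracket_formula n E x y)"
  "bracket_formula n E x (gscale c y) = gscale c (bracket_formula n E x y)"
proof -
  obtain v w u v' w' u' v'' w'' u'' where xyz: "x = (v, w, u)" "y = (v', w', u')" "z = (v'', w'', u'')"
    by (cases x; cases y; cases z)
  note defs = xyz bracket_formula_def A_map_linear gscale_def fscale_def
  show "bracket_formula n E (x + y) z = bracket_formula n E x z + bracket_formula n E y z"
    unfolding defs by (simp add: defs fun_eq_iff) (simp add: ring_distribs)
  show "bracket_formula n E x (y + z) = bracket_formula n E x y + bracket_formula n E x z"
    unfolding defs by (simp add: defs fun_eq_iff) (simp add: ring_distribs)
  show "bracket_formula n E (gscale c x) y = gscale c (bracket_formula n E x y)"
    unfolding defs by (simp add: defs fun_eq_iff A_map_scale) (simp add: ring_distribs ac_simps)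
  show "bracket_formula n E x (gscale c y) = gscale c (bracket_formula n E x y)"
    unfolding defs by (simp add: defs fun_eq_iff A_map_scale) (simp add: ring_distribs ac_simps)
qed

lemma bracket_formula_snd: "snd (snd (bracket_formula n E x y)) = 0"
  by (simp add: bracket_formula_def case_prod_unfold)

lemma bracket_formula_fst:
  assumes "snd (snd x) = 0" "snd (snd y) = 0"
  shows "fst (bracket_formula n E x y) = 0"
  using assms by (auto simp add: bracket_formula_def case_prod_unfold A_map_linear)

lemma bracket_formula_alternating: "bracket_formula n E x x = 0"
  by (cases x) (auto simp: bracket_formula_def fun_eq_iff zero_prod_def)

lemma bracket_formula_skew: "bracket_formula n E x y = - bracket_formula n E y x"
proof -
  have "bracket_formula n E (x + y) (x + y) = 0"
    by (rule bracket_formula_alternating)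
  then show ?thesis
    unfolding bracket_formula_bilinear
    by (simp add: bracket_formula_alternating eq_neg_iff_add_eq_0 add.commute)
qed

lemma bracket_formula_jacobi:
  "bracket_formula n E x (bracket_formula n E y z) + bracket_formula n E y (bracket_formula n E z x)
    + bracket_formula n E z (bracket_formula n E x y) = 0"
  by (cases x; cases y; cases z)
    (auto simp: bracket_formula_def A_map_linear fun_eq_iff zero_prod_def algebra_simps)

lemma linear_sum_gscale:
  fixes f :: "'k::field graph_vec \<Rightarrow> 'k graph_vec"
  assumes "\<And>x y. f (x + y) = f x + f y" "\<And>c x. f (gscale c x) = gscale c (f x)"
  shows "f (\<Sum>p\<in>S. gscale (c p) (b p)) = (\<Sum>p\<in>S. gscale (c p) (f (b p)))"
proof -
  have "f 0 = 0" using assms(1)[of 0 0] by simp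
  then show ?thesis
    by (induction S rule: infinite_finite_induct) (simp_all add: assms)
qed

lemma bracket_formula_basis:
  assumes "simple_graph n E" "p \<in> basis_indices n E" "q \<in> basis_indices n E"
  shows "bracket_formula n E (basis_elem p) (basis_elem q) =
    (basis_bracket E p q :: 'k::field graph_vec)"
proof -
  have loop: "{i} \<notin> E" for i using assms(1) by (rule simple_graph_noloop)
  have VV: "(if {a, b} \<in> E then evec i a * evec j b - evec i b * evec j a else 0) =
      (if {i, j} \<in> E then wedge (evec i) (evec j) (a, b) else (0::'k))" for i j a b
    using loop by (auto simp: wedge_def evec_def insert_commute)
  have EC: "wedge (evec i) (evec j) (a, b) *
      ((if a \<in> c then 1 else 0) + (if b \<in> c then 1 else 0)) =
      (if {i, j} \<subseteq> c then 2 else if i \<in> c \<or> j \<in> c then 1 else 0) *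
        (wedge (evec i) (evec j) (a, b) :: 'k)" for i j a b c
    by (auto simp: wedge_def evec_def)
  have evec_at: "evec i a * x = (if a = i then x else 0)" "evec i a = (if a = i then 1 else 0)"
    for i a :: nat and x :: 'k
    by (auto simp: evec_def)
  have EC_bracket: "bracket_formula n E (basis_elem (Edge i j)) (basis_elem (Clique c)) =
      (basis_bracket E (Edge i j) (Clique c) :: 'k graph_vec)" if "c \<in> cliques3 n E" for i j c
  proof -
    let ?k = "if {i, j} \<subseteq> c then 2 else if i \<in> c \<or> j \<in> c then 1 else (0::'k)"
    have A: "A_map n E (evec c) = (\<lambda>i. if i \<in> c then 1 else (0::'k))"
      using that by (rule A_map_evec)
    have "bracket_formula n E (basis_elem (Edge i j)) (basis_elem (Clique c)) =
        (0, \<lambda>(a, b). wedge (evec i) (evec j) (a, b) *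
          ((if a \<in> c then 1 else 0) + (if b \<in> c then 1 else (0::'k))), 0)"
      by (simp add: bracket_formula_def A A_map_linear fun_eq_iff)
    also have "\<dots> = gscale ?k (basis_elem (Edge i j))"
      unfolding EC by (simp add: gscale_def fscale_def fun_eq_iff)
    also have "\<dots> = basis_bracket E (Edge i j) (Clique c)"
      by (simp del: basis_elem.simps)
    finally show ?thesis .
  qed
  show ?thesis
  proof (cases p; cases q)
    fix i j assume "p = Vert i" "q = Vert j"
    then show ?thesis
      using VV[of _ _ i j] by (auto simp: bracket_formula_def A_map_linear fun_eq_iff zero_prod_def)
  next
    fix i c assume pq: "p = Vert i" "q = Clique c"
    then have "c \<in> cliques3 n E" using assms by (auto simp: basis_indices_def)
    then have "A_map n E (evec c) = (\<lambda>i. if i \<in> c then 1 else (0::'k))"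
      by (rule A_map_evec)
    with pq show ?thesis
      by (auto simp: bracket_formula_def A_map_linear fun_eq_iff zero_prod_def evec_at)
  next
    fix i c assume pq: "q = Vert i" "p = Clique c"
    then have "c \<in> cliques3 n E" using assms by (auto simp: basis_indices_def)
    then have "A_map n E (evec c) = (\<lambda>i. if i \<in> c then 1 else (0::'k))"
      by (rule A_map_evec)
    with pq show ?thesis
      by (auto simp: bracket_formula_def A_map_linear fun_eq_iff zero_prod_def evec_at)
  next
    fix i j c assume pq: "p = Edge i j" "q = Clique c"
    then have "c \<in> cliques3 n E" using assms by (auto simp: basis_indices_def)
    with pq show ?thesis by (simp only: EC_bracket)
  next
    fix i j c assume pq: "q = Edge i j" "p = Clique c"
    then have "c \<in> cliques3 n E" using assms by (auto simp: basis_indices_def)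
    note EC_bracket[OF this, of i j]
    then show ?thesis
      unfolding pq bracket_formula_skew[of _ _ "basis_elem (Clique c)"] by auto
  qed (auto simp: bracket_formula_def A_map_linear fun_eq_iff zero_prod_def)
qed

lemma graph_bracket_formula:
  assumes "simple_graph n E" "x \<in> graph_lie n E" "y \<in> graph_lie n E"
  shows "graph_bracket n E x y = bracket_formula n E x y"
proof -
  have "bracket_formula n E x y = bracket_formula n E
      (\<Sum>p\<in>basis_indices n E. gscale (basis_coord p x) (basis_elem p))
      (\<Sum>q\<in>basis_indices n E. gscale (basis_coord q y) (basis_elem q))"
    by (simp only: basis_expansion[OF assms(1,2)] basis_expansion[OF assms(1,3)])
  also have "\<dots> = (\<Sum>p\<in>basis_indices n E. gscale (basis_coord p x) (bracket_formula n E
      (basis_elem p) (\<Sum>q\<in>basis_indices n E. gscale (basis_coord q y) (basis_elem q))))"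
    by (rule linear_sum_gscale) (simp_all add: bracket_formula_bilinear)
  also have "\<dots> = (\<Sum>p\<in>basis_indices n E. gscale (basis_coord p x)
      (\<Sum>q\<in>basis_indices n E. gscale (basis_coord q y) (basis_bracket E p q)))"
  proof (intro sum.cong refl arg_cong[where f = "gscale _"])
    fix p assume p: "p \<in> basis_indices n E"
    have "bracket_formula n E (basis_elem p)
        (\<Sum>q\<in>basis_indices n E. gscale (basis_coord q y) (basis_elem q)) =
        (\<Sum>q\<in>basis_indices n E. gscale (basis_coord q y)
          (bracket_formula n E (basis_elem p) (basis_elem q)))"
      by (rule linear_sum_gscale) (simp_all add: bracket_formula_bilinear)
    also have "\<dots> = (\<Sum>q\<in>basis_indices n E. gscale (basis_coord q y) (basis_bracket E p q))"
      by (intro sum.cong refl) (simp add: bracket_formula_basis[OF assms(1) p])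
    finally show "bracket_formula n E (basis_elem p)
        (\<Sum>q\<in>basis_indices n E. gscale (basis_coord q y) (basis_elem q)) =
        (\<Sum>q\<in>basis_indices n E. gscale (basis_coord q y) (basis_bracket E p q))" .
  qed
  also have "\<dots> = graph_bracket n E x y"
    unfolding graph_bracket_def by (simp add: gvs.scale_sum_right)
  finally show ?thesis by simp
qed

lemma bracket_formula_closed:
  assumes "simple_graph n E" "x \<in> graph_lie n E" "y \<in> graph_lie n E"
  shows "bracket_formula n E x y \<in> graph_lie n E"
proof -
  obtain v w u v' w' u' where xy: "x = (v, w, u)" "y = (v', w', u')" by (cases x; cases y)
  note m = assms(2,3)[unfolded xy mem_graph_lie[OF assms(1)]]
  have w: "w \<in> edge_matrices E" "w' \<in> edge_matrices E" using m by auto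
  have sw: "w (b, a) = - w (a, b)" "w' (b, a) = - w' (a, b)" for a b
    using edge_matrixD(2) w by blast+
  show ?thesis
    unfolding xy bracket_formula_def prod.case mem_graph_lie[OF assms(1)]
  proof (intro conjI)
    show "(\<lambda>(a, b). (if {a, b} \<in> E then v a * v' b - v b * v' a else 0)
        + w (a, b) * (A_map n E u' a + A_map n E u' b)
        - w' (a, b) * (A_map n E u a + A_map n E u b)) \<in> edge_matrices E"
      unfolding edge_matrices_def
    proof (intro CollectI conjI allI impI, goal_cases)
      case (1 i)
      then show ?case using edge_matrixD(1)[OF w(1)] edge_matrixD(1)[OF w(2)] by simp
    next
      case (2 a b)
      show ?case
        unfolding prod.case sw[of b a] by (auto simp: insert_commute algebra_simps)
    next
      case (3 a b)
      then show ?case using edge_matrixD(3)[OF w(1)] edge_matrixD(3)[OF w(2)] by simp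
    qed
  qed (use m in auto)
qed

theorem graph_lie_algebra:
  assumes "simple_graph n E"
  shows "lie_algebra gscale (graph_lie n E :: 'k::field graph_vec set) (graph_bracket n E)"
proof -
  have sub: "gvs.subspace (graph_lie n E :: 'k graph_vec set)"
    unfolding gvs.subspace_def
    by (auto simp: graph_lie_def V_space_def W_space_def U_space_def gscale_def zero_prod_def
        intro: fvs.span_zero fvs.span_add fvs.span_scale)
  note [simp] = graph_bracket_formula[OF assms] bracket_formula_closed[OF assms]
    gvs.subspace_add[OF sub] gvs.subspace_scale[OF sub]
  show ?thesis
    by unfold_locales
      (simp_all add: sub bracket_formula_bilinear bracket_formula_alternating bracket_formula_jacobi)
qed

theorem graph_lie_solvable:
  assumes "simple_graph n E"
  shows "lie_solvable gscale (graph_bracket n E) (graph_lie n E :: 'k::field graph_vec set)"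
proof -
  let ?D = "derived_series gscale (graph_bracket n E) (graph_lie n E :: 'k graph_vec set)"
  have step: "bracket_span gscale (graph_bracket n E) S S \<subseteq> T"
    if "gvs.subspace T" "S \<subseteq> graph_lie n E" "\<And>x y. x \<in> S \<Longrightarrow> y \<in> S \<Longrightarrow> bracket_formula n E x y \<in> T"
    for S T :: "'k graph_vec set"
    unfolding bracket_span_def using that
    by (intro gvs.span_minimal) (auto simp: graph_bracket_formula[OF assms] subset_iff)
  have sub: "gvs.subspace (graph_lie n E :: 'k graph_vec set)"
    using graph_lie_algebra[OF assms] by (rule lie_algebra.subspace_carrier)
  have s1: "gvs.subspace {x \<in> graph_lie n E. snd (snd x) = (0 :: _ \<Rightarrow> 'k)}"
    and s2: "gvs.subspace {x \<in> graph_lie n E. fst x = (0 :: _ \<Rightarrow> 'k) \<and> snd (snd x) = 0}"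
    using gvs.subspace_0[OF sub] gvs.subspace_add[OF sub] gvs.subspace_scale[OF sub]
    by (auto simp: gvs.subspace_def) (simp_all add: gscale_def)
  have 1: "?D 1 \<subseteq> {x \<in> graph_lie n E. snd (snd x) = 0}"
    unfolding One_nat_def derived_series.simps
    by (rule step[OF s1]) (auto simp: bracket_formula_closed[OF assms] bracket_formula_snd)
  have 2: "?D 2 \<subseteq> {x \<in> graph_lie n E. fst x = 0 \<and> snd (snd x) = 0}"
    unfolding numeral_2_eq_2 derived_series.simps(2)[of _ _ _ "Suc 0"]
  proof (rule step[OF s2])
    show "?D (Suc 0) \<subseteq> graph_lie n E" using 1 by auto
    fix x y assume "x \<in> ?D (Suc 0)" "y \<in> ?D (Suc 0)"
    then have "x \<in> {x \<in> graph_lie n E. snd (snd x) = 0}" "y \<in> {x \<in> graph_lie n E. snd (snd x) = 0}"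
      using 1 unfolding One_nat_def by blast+
    then show "bracket_formula n E x y \<in> {x \<in> graph_lie n E. fst x = 0 \<and> snd (snd x) = 0}"
      by (simp add: bracket_formula_closed[OF assms] bracket_formula_snd bracket_formula_fst)
  qed
  have "?D 3 \<subseteq> {0}"
    unfolding numeral_3_eq_3 derived_series.simps(2)[of _ _ _ "Suc (Suc 0)"]
  proof (rule step)
    show "?D (Suc (Suc 0)) \<subseteq> graph_lie n E" using 2 unfolding numeral_2_eq_2 by blast
    fix x y assume "x \<in> ?D (Suc (Suc 0))" "y \<in> ?D (Suc (Suc 0))"
    then have "fst x = 0 \<and> snd (snd x) = 0" "fst y = 0 \<and> snd (snd y) = 0"
      using 2 unfolding numeral_2_eq_2 by blast+
    then show "bracket_formula n E x y \<in> {0}"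
      by (cases x; cases y)
        (auto simp: bracket_formula_def A_map_linear zero_prod_def zero_fun_def[symmetric])
  qed simp
  moreover have "0 \<in> ?D 3"
    by (simp add: numeral_3_eq_3 bracket_span_def gvs.span_zero)
  ultimately show ?thesis
    unfolding lie_solvable_def by blast
qed

end

(* In coordinates the bracket multiplies v by A u and each w(a,b) by (A u)(a) + (A u)(b), apart from
   the Heisenberg part V x V -> W.  So pairing a central element with the e_i gives A u = 0 and
   kills v off the isolated vertices, and pairing it with a 3-clique kills w on the edges that meet
   V_Delta; an edge inside the clique is scaled by 2, whence the restriction on the characteristic.
   V + W + ker A is nilpotent of class at most 2.  Conversely, if x = (v,w,u) has (A u)(a) /= 0, then
   ad x maps e_a to a nonzero multiple of e_a modulo W, so no nilpotent ideal contains x. *)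

theory Submission
  imports Defs
begin

section \<open>Characteristic and lower central series\<close>

lemma two_neq_zero_of_CHAR:
  assumes "CHAR('k::field) \<noteq> 2"
  shows "(2 :: 'k) \<noteq> 0"
proof
  assume "(2 :: 'k) = 0"
  then have "CHAR('k) dvd 2"
    using of_nat_eq_0_iff_char_dvd[where ?'a = 'k, of 2] by simp
  then have "CHAR('k) \<le> 2" "CHAR('k) \<noteq> 0"
    by (auto dest: dvd_imp_le intro!: Nat.gr0I)
  then show False
    using assms CHAR_not_1'[where ?'a = 'k] by linarith
qed

text \<open>Serves as an obstruction to nilpotency: if no iterate of \<open>br x\<close> kills
  \<open>y\<close>, then no term of the lower central series of \<open>S\<close> is
  \<open>{0}\<close>.\<close>

lemma (in vector_space) funpow_mem_lower_central:
  assumes "x \<in> S" "y \<in> S"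
  shows "(br x ^^ k) y \<in> lower_central scale br S k"
  using assms by (induction k) (auto simp: bracket_span_def intro!: span_base)

text \<open>Nilpotency asks for equality with \<open>{0}\<close>, so an upper bound on a term has to
  be complemented by this membership.\<close>

lemma (in vector_space) zero_mem_lower_central:
  assumes "0 \<in> S"
  shows "0 \<in> lower_central scale br S k"
  using assms by (cases k) (auto simp: bracket_span_def span_zero)

lemma (in vector_space) bracket_span_subset:
  assumes "subspace T" "\<And>x y. x \<in> S \<Longrightarrow> y \<in> S' \<Longrightarrow> br x y \<in> T"
  shows "bracket_span scale br S S' \<subseteq> T"
  unfolding bracket_span_def using assms by (intro span_minimal) auto

section \<open>Support of the incidence map and coordinate descriptions of the summands\<close>

text \<open>No 3-clique contains \<open>i\<close>, so row \<open>i\<close> of the incidence matrix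
  is zero.\<close>

lemma A_map_outside_V_Delta:
  assumes "i \<notin> V_Delta n E"
  shows "A_map n E u i = 0"
  using assms by (auto simp: A_map_def V_Delta_def clique_incidence_def intro!: sum.neutral)

text \<open>A 3-clique through \<open>i\<close> has a further vertex, and that vertex is adjacent to
  \<open>i\<close>.\<close>

lemma isolated_vertices_V_Delta_disjoint:
  assumes "i \<in> isolated_vertices n E"
  shows "i \<notin> V_Delta n E"
proof
  assume "i \<in> V_Delta n E"
  then obtain c where c: "c \<in> cliques3 n E" "i \<in> c" by (auto simp: V_Delta_def)
  have "\<not> c \<subseteq> {i}"
  proof
    assume "c \<subseteq> {i}"
    then have "card c \<le> 1" using card_mono[of "{i}" c] by simp
    then show False using c by (simp add: cliques3_def)
  qed
  then obtain j where "j \<in> c" "j \<noteq> i" by blast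
  then have "j \<in> {1..n}" "{i, j} \<in> E" using c by (auto simp: cliques3_def)
  then show False using assms by (simp add: isolated_vertices_def)
qed

lemma simple_graph_E_Gamma:
  assumes "simple_graph n E"
  shows "simple_graph n (E_Gamma n E)"
  using assms by (auto simp: simple_graph_def E_Gamma_def)

lemma mem_ker_A: "u \<in> ker_A n E \<longleftrightarrow> (\<forall>c. c \<notin> cliques3 n E \<longrightarrow> u c = 0) \<and> A_map n E u = 0"
  by (simp add: ker_A_def mem_U_space)

lemma zero_mem_ker_A: "0 \<in> ker_A n E"
  by (simp add: mem_ker_A A_map_linear)

lemma span_isolated:
  "fspan {evec \<alpha> | \<alpha>. \<alpha> \<in> isolated_vertices n E} =
    {v. \<forall>i. i \<notin> isolated_vertices n E \<longrightarrow> v i = 0}"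
  by (rule span_evec) (simp add: isolated_vertices_def)

text \<open>The span is the space \<open>W\<close> of the subgraph with edge set
  \<open>E_Gamma n E\<close>, so the description by alternating matrices carries over.\<close>

lemma span_E_Gamma:
  assumes "simple_graph n E"
  shows "fspan {wedge (evec \<alpha>) (evec \<beta>) | \<alpha> \<beta>. {\<alpha>, \<beta>} \<in> E_Gamma n E} = edge_matrices (E_Gamma n E)"
  using W_space_eq[OF simple_graph_E_Gamma[OF assms]] by (simp add: W_space_def)

section \<open>The center\<close>

lemma lie_center_graph_lie_subset:
  assumes "CHAR('k::field) \<noteq> 2" "simple_graph n E"
    and z: "(v, w, u) \<in> lie_center (graph_lie n E :: 'k graph_vec set) (graph_bracket n E)"
  shows "v \<in> fspan {evec \<alpha> | \<alpha>. \<alpha> \<in> isolated_vertices n E}"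
    and "w \<in> edge_matrices (E_Gamma n E)"
    and "u \<in> ker_A n E"
proof -
  have zL: "(v, w, u) \<in> graph_lie n E"
    using z by (simp add: lie_center_def)
  note m = zL[unfolded mem_graph_lie[OF assms(2)]]
  have w: "w \<in> edge_matrices E" using m by simp
  have zero: "bracket_formula n E (v, w, u) x = 0" if "x \<in> graph_lie n E" for x
    using z that zL by (simp add: lie_center_def graph_bracket_formula[OF assms(2)])
  have vert: "(evec i, 0, 0) \<in> (graph_lie n E :: 'k graph_vec set)" if "i \<in> {1..n}" for i
    using basis_elem_mem[OF assms(2), of "Vert i"] that by (simp add: basis_indices_def)
  have cliq: "(0, 0, evec c) \<in> (graph_lie n E :: 'k graph_vec set)" if "c \<in> cliques3 n E" for c
    using basis_elem_mem[OF assms(2), of "Clique c"] that by (simp add: basis_indices_def)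
  have v0: "v a = 0" if "{a, i} \<in> E" for a i
  proof -
    note e = simple_graph_edgeD[OF assms(2) that]
    \<comment> \<open>Since a differs from i, \<open>evec i a = 0\<close>, and entry (a, i) of the
      bracket with \<open>e_i\<close> is exactly \<open>v a\<close>.\<close>
    have "fst (snd (bracket_formula n E (v, w, u) (evec i, 0, 0))) (a, i) = 0"
      using zero[OF vert[OF e(2)]] by simp
    then show ?thesis
      using that e(3) by (simp add: bracket_formula_def A_map_linear evec_def)
  qed
  show "v \<in> fspan {evec \<alpha> | \<alpha>. \<alpha> \<in> isolated_vertices n E}"
    unfolding span_isolated using m v0 by (auto simp: isolated_vertices_def)
  have "A_map n E u i = 0" for i
  proof (cases "i \<in> {1..n}")
    case True
    \<comment> \<open>This coordinate equals \<open>- A_map n E u i\<close>.\<close>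
    have "fst (bracket_formula n E (v, w, u) (evec i, 0, 0)) i = 0"
      using zero[OF vert[OF True]] by simp
    then show ?thesis
      by (simp add: bracket_formula_def A_map_linear evec_def)
  \<comment> \<open>Outside \<open>{1..n}\<close> the map takes its default value 0.\<close>
  qed (simp only: A_map_def if_False)
  then show "u \<in> ker_A n E"
    using m by (simp add: mem_ker_A fun_eq_iff)
  have w0: "w (a, b) = 0" if a: "a \<in> V_Delta n E" for a b
  proof -
    obtain c where c: "c \<in> cliques3 n E" "a \<in> c" using a by (auto simp: V_Delta_def)
    have "fst (snd (bracket_formula n E (v, w, u) (0, 0, evec c))) (a, b) = 0"
      using zero[OF cliq[OF c(1)]] by simp
    \<comment> \<open>The factor is 2 or 1, according to whether the clique contains
      \<open>b\<close>.\<close>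
    then have "w (a, b) * (1 + (if b \<in> c then 1 else 0)) = 0"
      using c by (simp add: bracket_formula_def A_map_evec(1)[OF c(1)] split: if_splits)
    then show ?thesis
      using two_neq_zero_of_CHAR[OF assms(1)] by (simp split: if_splits)
  qed
  have "w (a, b) = 0" if "{a, b} \<notin> E_Gamma n E" for a b
  proof (cases "{a, b} \<in> E")
    case True
    then have "a \<in> V_Delta n E \<or> b \<in> V_Delta n E"
      using that simple_graph_edgeD[OF assms(2) True] by (auto simp: E_Gamma_def V_Gamma_def)
    \<comment> \<open>\<open>w0\<close> requires the first index in \<open>V_Delta\<close>; if only
      \<open>b\<close> lies there, skew-symmetry of \<open>w\<close> exchanges the indices.\<close>
    then show ?thesis
      using w0[of a b] w0[of b a] edge_matrixD(2)[OF w, of b a] by auto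
  qed (rule edge_matrixD(3)[OF w])
  then show "w \<in> edge_matrices (E_Gamma n E)"
    using w by (simp add: edge_matrices_def)
qed

text \<open>Each summand of \<open>bracket_formula\<close> vanishes separately. The support of
  \<open>v\<close> meets no edge and avoids \<open>V_Delta\<close>, where every \<open>A u'\<close>
  is supported; the edges carrying \<open>w\<close> avoid \<open>V_Delta\<close> as well; and
  \<open>A u = 0\<close> removes the terms with \<open>v'\<close> and \<open>w'\<close> as factors
  of \<open>A u\<close>.\<close>

lemma lie_center_graph_lie_supset:
  fixes v :: "nat \<Rightarrow> 'k::field"
  assumes "simple_graph n E"
    and v: "v \<in> fspan {evec \<alpha> | \<alpha>. \<alpha> \<in> isolated_vertices n E}"
    and w: "w \<in> edge_matrices (E_Gamma n E)"
    and u: "u \<in> ker_A n E"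
  shows "(v, w, u) \<in> lie_center (graph_lie n E) (graph_bracket n E)"
proof -
  have v0: "v i = 0" if "i \<notin> isolated_vertices n E" for i
    using v that by (simp add: span_isolated)
  have A0: "A_map n E u = 0" using u by (simp add: mem_ker_A)
  have wE: "w \<in> edge_matrices E"
    using w by (auto simp: edge_matrices_def E_Gamma_def)
  have zL: "(v, w, u) \<in> graph_lie n E"
    using v0 wE u by (auto simp: mem_graph_lie[OF assms(1)] mem_ker_A isolated_vertices_def)
  have vA: "v a * A_map n E u' a = 0" for a u'
    using v0[of a] isolated_vertices_V_Delta_disjoint[of a n E] A_map_outside_V_Delta[of a n E u']
    by auto
  have vE: "v a = 0" if "{a, b} \<in> E" for a b
    using that v0[of a] simple_graph_edgeD(2)[OF assms(1) that]
    unfolding isolated_vertices_def by blast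
  have wA: "w (a, b) * (A_map n E u' a + A_map n E u' b) = 0" for a b u'
  proof (cases "{a, b} \<in> E_Gamma n E")
    case True
    then have "a \<notin> V_Delta n E" "b \<notin> V_Delta n E" by (auto simp: E_Gamma_def V_Gamma_def)
    then show ?thesis by (simp add: A_map_outside_V_Delta)
  qed (simp add: edge_matrixD(3)[OF w])
  have "graph_bracket n E (v, w, u) x = 0" if x: "x \<in> graph_lie n E" for x
  proof -
    obtain v' w' u' where x': "x = (v', w', u')" by (cases x)
    have "(if {a, b} \<in> E then v a * v' b - v b * v' a else 0) = 0" for a b
      using vE[of a b] vE[of b a] by (auto simp: insert_commute)
    then have "bracket_formula n E (v, w, u) x = 0"
      unfolding x' bracket_formula_def prod.case A0 vA wA
      by (simp add: zero_prod_def fun_eq_iff)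
    then show ?thesis
      using graph_bracket_formula[OF assms(1) zL x] by simp
  qed
  then show ?thesis
    using zL by (simp add: lie_center_def)
qed

section \<open>The nilradical\<close>

lemma subspace_ker_A: "fvs.subspace (ker_A n E)"
  by (simp add: fvs.subspace_def mem_ker_A A_map_linear)
    (auto simp: fscale_def mem_ker_A)

lemma subspace_graph_vec_Times:
  assumes "fvs.subspace S" "fvs.subspace T" "fvs.subspace R"
  shows "gvs.subspace (S \<times> T \<times> R)"
  using assms by (auto simp: gvs.subspace_def fvs.subspace_def gscale_def zero_prod_def)

text \<open>Every bracket has zero U-component, and 0 lies in the kernel of A; thus all brackets
  already fall into the candidate.\<close>

lemma lie_ideal_ker_A:
  assumes "simple_graph n E"
  shows "lie_ideal gscale (graph_lie n E :: 'k::field graph_vec set) (graph_bracket n E)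
    (V_space n \<times> W_space E \<times> ker_A n E)"
  unfolding lie_ideal_def
proof (intro conjI ballI)
  let ?N = "V_space n \<times> W_space E \<times> ker_A n E :: 'k graph_vec set"
  show "gvs.subspace ?N"
    unfolding V_space_def W_space_def
    by (intro subspace_graph_vec_Times fvs.subspace_span subspace_ker_A)
  show NL: "?N \<subseteq> graph_lie n E"
    by (auto simp: graph_lie_def ker_A_def)
  fix x y :: "'k graph_vec" assume xy: "x \<in> graph_lie n E" "y \<in> ?N"
  then have y: "y \<in> graph_lie n E" using NL by blast
  show "graph_bracket n E x y \<in> ?N"
    using bracket_formula_closed[OF assms xy(1) y] bracket_formula_snd[of n E x y]
    by (cases "bracket_formula n E x y")
      (simp add: graph_bracket_formula[OF assms xy(1) y] graph_lie_def zero_mem_ker_A)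
qed

lemma lie_nilpotent_ker_A:
  assumes "simple_graph n E"
  shows "lie_nilpotent gscale (graph_bracket n E)
    (V_space n \<times> W_space E \<times> ker_A n E :: 'k::field graph_vec set)"
proof -
  let ?N = "V_space n \<times> W_space E \<times> ker_A n E :: 'k graph_vec set"
  let ?W = "{x \<in> graph_lie n E. fst x = (0 :: _ \<Rightarrow> 'k) \<and> snd (snd x) = 0}"
  let ?C = "lower_central gscale (graph_bracket n E) ?N"
  have N: "gvs.subspace ?N" "?N \<subseteq> graph_lie n E"
    using lie_ideal_ker_A[OF assms] by (auto simp: lie_ideal_def)
  have sub: "gvs.subspace (graph_lie n E :: 'k graph_vec set)"
    using graph_lie_algebra[OF assms] by (rule lie_algebra.subspace_carrier)
  have W: "gvs.subspace ?W"
    using gvs.subspace_0[OF sub] gvs.subspace_add[OF sub] gvs.subspace_scale[OF sub]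
    by (auto simp: gvs.subspace_def) (simp_all add: gscale_def)
  have 1: "?C 1 \<subseteq> ?W"
    unfolding One_nat_def lower_central.simps
  proof (rule gvs.bracket_span_subset[OF W])
    fix x y assume xy: "x \<in> ?N" "y \<in> ?N"
    then have L: "x \<in> graph_lie n E" "y \<in> graph_lie n E" using N(2) by blast+
    \<comment> \<open>Both U-components are killed by A, so the V-component, which is linear in
      \<open>A u\<close> and \<open>A u'\<close>, disappears.\<close>
    have "fst (bracket_formula n E x y) = 0"
      using xy by (auto simp: bracket_formula_def mem_ker_A fun_eq_iff)
    then show "graph_bracket n E x y \<in> ?W"
      by (simp add: graph_bracket_formula[OF assms L] bracket_formula_closed[OF assms L]
          bracket_formula_snd)
  qed
  have "?C 2 \<subseteq> {0}"
    unfolding numeral_2_eq_2 lower_central.simps(2)[of _ _ _ "Suc 0"]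
  proof (rule gvs.bracket_span_subset)
    fix x y assume xy: "x \<in> ?N" "y \<in> ?C (Suc 0)"
    then have "y \<in> ?W" using 1 by auto
    then have L: "x \<in> graph_lie n E" "y \<in> graph_lie n E"
      and y: "fst y = 0" "snd (snd y) = 0" using N(2) xy(1) by blast+
    obtain v w u v' w' u' where x': "x = (v, w, u)" and y': "y = (v', w', u')"
      by (cases x; cases y)
    \<comment> \<open>Only \<open>w'\<close> survives in \<open>y\<close>, and it is multiplied by
      values of \<open>A u\<close>, which is 0.\<close>
    have "bracket_formula n E x y = 0"
      using xy(1) y
      by (simp add: x' y' bracket_formula_def mem_ker_A A_map_linear zero_prod_def)
        (simp add: fun_eq_iff)
    then show "graph_bracket n E x y \<in> {0}"
      by (simp add: graph_bracket_formula[OF assms L])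
  qed simp
  moreover have "0 \<in> ?C 2"
    using gvs.subspace_0[OF N(1)] by (rule gvs.zero_mem_lower_central)
  ultimately show ?thesis
    unfolding lie_nilpotent_def by blast
qed

lemma nilpotent_ideal_subset_ker_A:
  fixes I :: "'k::field graph_vec set"
  assumes "simple_graph n E"
    and I: "lie_ideal gscale (graph_lie n E) (graph_bracket n E) I"
    and nil: "lie_nilpotent gscale (graph_bracket n E) I"
  shows "I \<subseteq> V_space n \<times> W_space E \<times> ker_A n E"
proof
  fix x assume xI: "x \<in> I"
  obtain v w u where x: "x = (v, w, u)" by (cases x)
  have IL: "I \<subseteq> graph_lie n E"
    and Ibr: "\<And>x y. x \<in> graph_lie n E \<Longrightarrow> y \<in> I \<Longrightarrow> graph_bracket n E x y \<in> I"
    using I by (auto simp: lie_ideal_def)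
  have xL: "x \<in> graph_lie n E" using xI IL by blast
  have "A_map n E u a = 0" for a
  proof (rule ccontr)
    assume A: "A_map n E u a \<noteq> 0"
    then have a: "a \<in> {1..n}" unfolding A_map_def by meson
    let ?e = "(evec a, 0, 0) :: 'k graph_vec"
    \<comment> \<open>A starting vector inside the ideal is needed, and \<open>e_a\<close> itself is
      not known to lie in \<open>I\<close>. This bracket does, has no U-component, and its
      coordinate at \<open>a\<close> is \<open>A_map n E u a\<close>.\<close>
    define y where "y = graph_bracket n E ?e x"
    have e: "?e \<in> graph_lie n E"
      using basis_elem_mem[OF assms(1), of "Vert a"] a by (simp add: basis_indices_def)
    have yI: "y \<in> I" unfolding y_def by (rule Ibr[OF e xI])
    \<comment> \<open>Because \<open>z\<close> has no U-component, the term
      \<open>v a * A u' a\<close> drops out and bracketing with \<open>x\<close> multiplies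
      coordinate \<open>a\<close> by the nonzero scalar \<open>- A_map n E u a\<close>. The result
      again has no U-component, so the step can be iterated.\<close>
    have step: "graph_bracket n E x z \<in> I \<and> fst (graph_bracket n E x z) a \<noteq> 0 \<and>
        snd (snd (graph_bracket n E x z)) = 0"
      if z: "z \<in> I" "fst z a \<noteq> 0" "snd (snd z) = 0" for z
    proof -
      obtain v' w' u' where z': "z = (v', w', u')" by (cases z)
      have "graph_bracket n E x z = bracket_formula n E x z"
        using z(1) IL by (intro graph_bracket_formula[OF assms(1) xL]) blast
      moreover have "fst (bracket_formula n E x z) a \<noteq> 0"
        using z(2,3) A by (simp add: z' x bracket_formula_def A_map_linear)
      ultimately show ?thesis
        using Ibr[OF xL z(1)] bracket_formula_snd[of n E x z] by simp
    qed
    have pow: "(graph_bracket n E x ^^ k) y \<in> I \<and>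
        fst ((graph_bracket n E x ^^ k) y) a \<noteq> 0 \<and>
        snd (snd ((graph_bracket n E x ^^ k) y)) = 0" for k
    proof (induction k)
      case 0
      have "y = bracket_formula n E ?e x"
        unfolding y_def by (rule graph_bracket_formula[OF assms(1) e xL])
      then show ?case
        using yI A bracket_formula_snd[of n E ?e x]
        by (simp add: x bracket_formula_def A_map_linear evec_def)
    next
      case (Suc k)
      then show ?case unfolding funpow.simps comp_apply by (intro step) blast+
    qed
    obtain k where "lower_central gscale (graph_bracket n E) I k = {0}"
      using nil by (auto simp: lie_nilpotent_def)
    then have "(graph_bracket n E x ^^ k) y = 0"
      using gvs.funpow_mem_lower_central[OF xI yI, of k "graph_bracket n E"]
      by simp
    then show False using pow[of k] by simp
  qed
  then show "x \<in> V_space n \<times> W_space E \<times> ker_A n E"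
    using xL by (simp add: x graph_lie_def ker_A_def fun_eq_iff)
qed

theorem proposition2p7:
  fixes n :: nat and E :: "nat set set"
  assumes "CHAR('k::field) \<noteq> 2"
    and "simple_graph n E"
  shows
    "lie_center (graph_lie n E :: 'k graph_vec set) (graph_bracket n E) =
       fspan {evec \<alpha> | \<alpha>. \<alpha> \<in> isolated_vertices n E} \<times>
       fspan {wedge (evec \<alpha>) (evec \<beta>) | \<alpha> \<beta>. {\<alpha>, \<beta>} \<in> E_Gamma n E} \<times>
       ker_A n E
     \<and> is_nilradical gscale (graph_lie n E :: 'k graph_vec set) (graph_bracket n E)
       (V_space n \<times> W_space E \<times> ker_A n E)"
proof
  show "lie_center (graph_lie n E :: 'k graph_vec set) (graph_bracket n E) =
       fspan {evec \<alpha> | \<alpha>. \<alpha> \<in> isolated_vertices n E} \<times>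
       fspan {wedge (evec \<alpha>) (evec \<beta>) | \<alpha> \<beta>. {\<alpha>, \<beta>} \<in> E_Gamma n E} \<times>
       ker_A n E"
    unfolding span_E_Gamma[OF assms(2)]
    by (intro set_eqI iffI)
      (auto simp only: mem_Times_iff fst_conv snd_conv split_paired_all
        intro: lie_center_graph_lie_subset[OF assms] lie_center_graph_lie_supset[OF assms(2)])
  show "is_nilradical gscale (graph_lie n E :: 'k graph_vec set) (graph_bracket n E)
       (V_space n \<times> W_space E \<times> ker_A n E)"
    unfolding is_nilradical_def
    using lie_ideal_ker_A[OF assms(2)] lie_nilpotent_ker_A[OF assms(2)]
      nilpotent_ideal_subset_ker_A[OF assms(2)] by blast
qed

end
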